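(* Let $n\ge 3$. Consider the board with two bounded cells formed by a cycle graph $C_n$ embedded in the plane together with one additional vertex $a$ inside the cycle that is joined by edges to exactly two adjacent vertices $b$ and $c$ of the cycle (and to no other vertices); the cells are the triangle $abc$ and a cell with $n+1$ boundary edges. In the Game of Cycles on this board, if $n$ is odd then Player~1 has a winning strategy, and if $n$ is even then Player~2 has a winning strategy.
   Context: The Game of Cycles. A board is a simple connected planar graph embedded in the plane, together with its bounded cells. Two players alternate turns; on a turn a player marks one unmarked edge with an arrow pointing along the edge in one of its two directions. Each edge receives at most one arrow, and arrows have the same effect regardless of who placed them. Moves must obey the sink-source rule: no move may create a sink (a vertex all of whose incident edges are marked with arrows pointing toward it) or a source (a vertex all of whose incident edges are marked with arrows pointing away from it). A player who has a legal move must make one. A cycle cell is a bounded cell all of whose boundary edges are marked with arrows all cycling in the same direction around that cell. The first player to create a cycle cell wins; if play ends (no legal move remains) without a cycle cell, the player who made the last move wins. A winning strategy guarantees a win regardless of the opponent's moves. *)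

theory Defs
  imports Main
begin

text \<open>A board: vertex set, edge set (2-element vertex sets), and the bounded cells,
each given by its boundary as a cyclic list of vertices.  A position is the set of
arrows placed so far; an arrow (u,v) marks the edge {u,v} pointing from u to v.\<close>

record board =
  verts :: "nat set"
  edges :: "nat set set"
  cells :: "nat list list"

type_synonym position = "(nat \<times> nat) set"

definition is_sink :: "board \<Rightarrow> position \<Rightarrow> nat \<Rightarrow> bool" where
  "is_sink B M x \<longleftrightarrow> x \<in> verts B \<and> (\<forall>y. {x, y} \<in> edges B \<longrightarrow> (y, x) \<in> M)"

definition is_source :: "board \<Rightarrow> position \<Rightarrow> nat \<Rightarrow> bool" where
  "is_source B M x \<longleftrightarrow> x \<in> verts B \<and> (\<forall>y. {x, y} \<in> edges B \<longrightarrow> (x, y) \<in> M)"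

definition legal_moves :: "board \<Rightarrow> position \<Rightarrow> (nat \<times> nat) set" where
  "legal_moves B M = {(u, v). {u, v} \<in> edges B \<and> (u, v) \<notin> M \<and> (v, u) \<notin> M \<and>
      (\<forall>x. \<not> is_sink B (insert (u, v) M) x \<and> \<not> is_source B (insert (u, v) M) x)}"

definition is_cycle_cell :: "position \<Rightarrow> nat list \<Rightarrow> bool" where
  "is_cycle_cell M c \<longleftrightarrow>
     (\<forall>i < length c. (c ! i, c ! ((i + 1) mod length c)) \<in> M) \<or>
     (\<forall>i < length c. (c ! ((i + 1) mod length c), c ! i) \<in> M)"

definition has_cycle_cell :: "board \<Rightarrow> position \<Rightarrow> bool" where
  "has_cycle_cell B M \<longleftrightarrow> (\<exists>c \<in> set (cells B). is_cycle_cell M c)"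

text \<open>mover_wins_fuel B k M: the player to move at position M has a winning strategy
within the next k moves (backward induction): some legal move either creates a cycle
cell, or leaves the opponent in a losing position (in particular a position with no
legal move, in which case the mover made the last move and wins).\<close>
fun mover_wins_fuel :: "board \<Rightarrow> nat \<Rightarrow> position \<Rightarrow> bool" where
  "mover_wins_fuel B 0 M = False"
| "mover_wins_fuel B (Suc k) M =
     (\<exists>m \<in> legal_moves B M. has_cycle_cell B (insert m M) \<or> \<not> mover_wins_fuel B k (insert m M))"

text \<open>Since each edge is marked at most once, the game lasts at most card (edges B) moves,
so this fuel suffices.\<close>
definition mover_wins :: "board \<Rightarrow> position \<Rightarrow> bool" where
  "mover_wins B M = mover_wins_fuel B (card (edges B)) M"

definition player1_wins :: "board \<Rightarrow> bool" where
  "player1_wins B \<longleftrightarrow> mover_wins B {}"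

definition player2_wins :: "board \<Rightarrow> bool" where
  "player2_wins B \<longleftrightarrow> (\<forall>m \<in> legal_moves B {}. \<not> has_cycle_cell B {m} \<and> mover_wins B {m})"

text \<open>The board: cycle C_n on vertices 0..n-1 (edges {i,(i+1) mod n}), extra vertex a = n
inside, joined to the adjacent cycle vertices b = 0 and c = 1.  Cells: the triangle a b c
and the cell with boundary a,1,2,...,n-1,0 (n+1 edges).\<close>
definition cycle_chord_board :: "nat \<Rightarrow> board" where
  "cycle_chord_board n =
     \<lparr> verts = {0..n},
       edges = {{i, (i + 1) mod n} | i. i < n} \<union> {{n, 0}, {n, 1}},
       cells = [[n, 0, 1], n # [1..<n] @ [0]] \<rparr>"

end

theory Submission
  imports Defs
begin

text \<open>The board is a theta graph: the vertices 0 and 1 are joined by the edge x, by the path y1, y2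
through the vertex n, and by a path z_1, ..., z_{n-1}.  With every path oriented from 0 to 1, a move
gives an edge a sign.  The sink-source rule says that consecutive marked edges of a path agree in
sign, and that neither x, y1, z_1 nor x, y2, z_{n-1} all carry the same sign.  Reflecting the board
and reversing the arrows preserves all signs, so the basic strategy is to answer a move on an edge by
the same sign on its mirror image; an opponent then never completes a cell.

For odd n only x is its own mirror image, and Player 1 begins with x.  For even n the middle edge z_m
with m = n/2 is also self-mirrored, and Player 2 pairs x with z_m.  This breaks down when Player 1
plays y1 with sign t while x is unmarked, since the mirrored answer would allow the completion of the
triangle.  If z_1 is not t, Player 2 plays x with sign t and pairs y2 with z_m; should Player 1 then
mark z_{n-1} with t, y2 is dead, no cell can be completed any more and parity decides.  If z_1 and
z_{n-1} both have sign t, then whoever first plays x or y2 loses to a triangle, and the parity of the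
number of moves remaining on the z path forces Player 1 to do so.

The parity argument is that an exhausted path with marked ends has an unmarked edge exactly where
the sign changes.\<close>

section \<open>Encoding of positions by signs on the edges of the theta graph\<close>

locale chord_board =
  fixes n :: nat
  assumes n_ge_3: "3 \<le> n"
begin

text \<open>Edges are indexed by 0 for x, i for z_i with 1 <= i < n, n for y1 and n + 1 for y2.\<close>

definition src :: "nat \<Rightarrow> nat" where
  "src j = (if j = 0 \<or> j = 1 \<or> j = n then 0 else if j = n + 1 then n else n + 1 - j)"

definition dst :: "nat \<Rightarrow> nat" where
  "dst j = (if j = 0 \<or> j = n + 1 then 1 else if j = n then n else n - j)"

text \<open>None is an unmarked edge, Some True an arrow along the orientation from 0 to 1.\<close>

definition pos :: "(nat \<Rightarrow> bool option) \<Rightarrow> position" where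
  "pos s = {(src j, dst j) | j. j \<le> n + 1 \<and> s j = Some True} \<union>
           {(dst j, src j) | j. j \<le> n + 1 \<and> s j = Some False}"

text \<open>The four clauses belong, in order, to the inner vertices of the z path and to the
  vertices \<open>n\<close>, 0 and 1. At a vertex of degree two one edge enters and the other
  leaves, so a sink or source there means opposite signs. At 0 all three edges leave and at 1 all
  three enter, so there it means equal signs.\<close>

definition ok :: "(nat \<Rightarrow> bool option) \<Rightarrow> bool" where
  "ok s \<longleftrightarrow>
     (\<forall>i t. 1 \<le> i \<and> i + 1 < n \<and> s i = Some t \<longrightarrow> s (i + 1) \<noteq> Some (\<not> t)) \<and>
     (\<forall>t. s n = Some t \<longrightarrow> s (n + 1) \<noteq> Some (\<not> t)) \<and>
     (\<forall>t. \<not> (s 0 = Some t \<and> s 1 = Some t \<and> s n = Some t)) \<and>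
     (\<forall>t. \<not> (s 0 = Some t \<and> s (n - 1) = Some t \<and> s (n + 1) = Some t))"

text \<open>Both bounded cells contain y1 and y2. What closes the cycle, x or the whole z path, also
  runs from 0 to 1 and must therefore carry the opposite sign.\<close>

definition cell :: "(nat \<Rightarrow> bool option) \<Rightarrow> bool" where
  "cell s \<longleftrightarrow> (\<exists>t. s n = Some t \<and> s (n + 1) = Some t \<and>
     (s 0 = Some (\<not> t) \<or> (\<forall>i. 1 \<le> i \<and> i < n \<longrightarrow> s i = Some (\<not> t))))"

definition legal :: "(nat \<Rightarrow> bool option) \<Rightarrow> nat \<Rightarrow> bool \<Rightarrow> bool" where
  "legal s j t \<longleftrightarrow> j \<le> n + 1 \<and> s j = None \<and> ok (s(j := Some t))"

abbreviation B :: board where "B \<equiv> cycle_chord_board n"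

section \<open>Edges and arrows of the board\<close>

lemma index_cases [consumes 1]:
  assumes "j \<le> n + 1"
  obtains "j = 0" | "j = 1" | "j = n" | "j = n + 1" | "2 \<le> j" "j < n"
  using assms by linarith

lemma src_simps [simp]:
  "src 0 = 0" "src (Suc 0) = 0" "src n = 0" "src (Suc n) = n"
  "2 \<le> j \<Longrightarrow> j < n \<Longrightarrow> src j = n + 1 - j"
  using n_ge_3 by (simp_all add: src_def)

lemma dst_simps [simp]:
  "dst 0 = 1" "dst n = n" "dst (Suc n) = 1"
  "1 \<le> j \<Longrightarrow> j < n \<Longrightarrow> dst j = n - j"
  using n_ge_3 by (simp_all add: dst_def)

lemma edges_B: "edges B = (\<lambda>j. {src j, dst j}) ` {..n + 1}"
proof -
  \<comment> \<open>The z path runs against the numbering of the cycle: the edge from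
    \<open>i\<close> to \<open>i + 1\<close> is z_{n-i} for \<open>1 \<le> i\<close>, the closing
    edge between \<open>n - 1\<close> and 0 is z_1, and \<open>i = 0\<close> gives x.\<close>
  have "(\<lambda>i. {i, (i + 1) mod n}) ` {..<n} = (\<lambda>j. {src j, dst j}) ` {..<n}" (is "?C = ?P")
  proof (intro equalityI subsetI)
    fix e assume "e \<in> ?C"
    then obtain i where i: "i < n" "e = {i, (i + 1) mod n}" by blast
    consider "i = 0" | "i = n - 1" | "1 \<le> i" "i < n - 1" using i(1) by linarith
    then show "e \<in> ?P"
    proof cases
      case 1
      then show ?thesis using i n_ge_3 by (intro image_eqI[of _ _ 0]) auto
    next
      case 2
      then show ?thesis using i n_ge_3 by (intro image_eqI[of _ _ 1]) auto
    next
      case 3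
      then have "src (n - i) = i + 1" "dst (n - i) = i" by auto
      then have "e = {src (n - i), dst (n - i)}" using i 3 by auto
      then show ?thesis using 3 by (intro image_eqI[of _ _ "n - i"]) auto
    qed
  next
    fix e assume "e \<in> ?P"
    then obtain j where j: "j < n" "e = {src j, dst j}" by blast
    then consider "j = 0" | "j = 1" | "2 \<le> j" by linarith
    then show "e \<in> ?C"
    proof cases
      case 1
      then show ?thesis using j n_ge_3 by (intro image_eqI[of _ _ 0]) auto
    next
      case 2
      then show ?thesis using j n_ge_3 by (intro image_eqI[of _ _ "n - 1"]) auto
    next
      case 3
      then show ?thesis using j by (intro image_eqI[of _ _ "n - j"]) (auto simp: Suc_diff_le)
    qed
  qed
  moreover have "{..n + 1} = {..<n} \<union> {n, n + 1}" by auto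
  moreover have "edges B = (\<lambda>i. {i, (i + 1) mod n}) ` {..<n} \<union> {{n, 0}, {n, 1}}"
    unfolding cycle_chord_board_def by (auto simp: image_iff)
  ultimately show ?thesis by (simp add: image_Un insert_commute)
qed

lemma edge_inj:
  assumes "{src i, dst i} = {src j, dst j}" "i \<le> n + 1" "j \<le> n + 1"
  shows "i = j"
  by (rule index_cases[OF assms(2)]; rule index_cases[OF assms(3)];
      use assms(1) n_ge_3 in \<open>auto simp: doubleton_eq_iff\<close>)

lemma src_neq_dst: "j \<le> n + 1 \<Longrightarrow> src j \<noteq> dst j"
  using n_ge_3 by (erule_tac index_cases) auto

lemma card_edges: "card (edges B) = n + 2"
proof -
  have "inj_on (\<lambda>j. {src j, dst j}) {..n + 1}"
    using edge_inj by (auto intro!: inj_onI)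
  then show ?thesis by (simp add: edges_B card_image)
qed

text \<open>An arrow determines both its edge index and its sign, so a sign assignment can be read
  back from \<open>pos\<close>.\<close>

lemma arrow_eq_iff:
  assumes "i \<le> n + 1" "j \<le> n + 1"
  shows "src i = src j \<and> dst i = dst j \<longleftrightarrow> i = j" "\<not> (src i = dst j \<and> dst i = src j)"
proof -
  show "src i = src j \<and> dst i = dst j \<longleftrightarrow> i = j" using edge_inj[of i j] assms by auto
  show "\<not> (src i = dst j \<and> dst i = src j)"
  proof
    assume *: "src i = dst j \<and> dst i = src j"
    then have "i = j" using edge_inj[of i j] assms by (simp add: insert_commute)
    then show False using * src_neq_dst assms by auto
  qed
qed

lemma forward_in_pos:
  assumes "j \<le> n + 1"
  shows "(src j, dst j) \<in> pos s \<longleftrightarrow> s j = Some True"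
proof -
  have "(src j, dst j) \<in> pos s \<longleftrightarrow>
      (\<exists>i. i \<le> n + 1 \<and> s i = Some True \<and> (src j = src i \<and> dst j = dst i)) \<or>
      (\<exists>i. i \<le> n + 1 \<and> s i = Some False \<and> (src j = dst i \<and> dst j = src i))"
    by (auto simp: pos_def)
  then show ?thesis using arrow_eq_iff[OF assms] assms by metis
qed

lemma backward_in_pos:
  assumes "j \<le> n + 1"
  shows "(dst j, src j) \<in> pos s \<longleftrightarrow> s j = Some False"
proof -
  have "(dst j, src j) \<in> pos s \<longleftrightarrow>
      (\<exists>i. i \<le> n + 1 \<and> s i = Some True \<and> (src j = dst i \<and> dst j = src i)) \<or>
      (\<exists>i. i \<le> n + 1 \<and> s i = Some False \<and> (src j = src i \<and> dst j = dst i))"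
    by (auto simp: pos_def)
  then show ?thesis using arrow_eq_iff[OF assms] assms by metis
qed

section \<open>The sink-source rule in terms of signs\<close>

lemma edge_at_iff: "{x, y} \<in> edges B \<longleftrightarrow>
   (\<exists>j\<le>n + 1. src j = x \<and> dst j = y \<or> dst j = x \<and> src j = y)"
  by (auto simp: edges_B doubleton_eq_iff)

lemma is_sink_pos: "is_sink B (pos s) x \<longleftrightarrow> x \<le> n \<and>
   (\<forall>j\<le>n + 1. (src j = x \<longrightarrow> s j = Some False) \<and> (dst j = x \<longrightarrow> s j = Some True))"
proof -
  have "(\<forall>y. {x, y} \<in> edges B \<longrightarrow> (y, x) \<in> pos s) \<longleftrightarrow>
    (\<forall>j\<le>n + 1. (src j = x \<longrightarrow> (dst j, src j) \<in> pos s) \<and> (dst j = x \<longrightarrow> (src j, dst j) \<in> pos s))"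
    unfolding edge_at_iff by blast
  also have "\<dots> \<longleftrightarrow> (\<forall>j\<le>n + 1. (src j = x \<longrightarrow> s j = Some False) \<and> (dst j = x \<longrightarrow> s j = Some True))"
    using forward_in_pos backward_in_pos by blast
  finally show ?thesis by (simp add: is_sink_def cycle_chord_board_def)
qed

lemma is_source_pos: "is_source B (pos s) x \<longleftrightarrow> x \<le> n \<and>
   (\<forall>j\<le>n + 1. (src j = x \<longrightarrow> s j = Some True) \<and> (dst j = x \<longrightarrow> s j = Some False))"
proof -
  have "(\<forall>y. {x, y} \<in> edges B \<longrightarrow> (x, y) \<in> pos s) \<longleftrightarrow>
    (\<forall>j\<le>n + 1. (src j = x \<longrightarrow> (src j, dst j) \<in> pos s) \<and> (dst j = x \<longrightarrow> (dst j, src j) \<in> pos s))"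
    unfolding edge_at_iff by blast
  also have "\<dots> \<longleftrightarrow> (\<forall>j\<le>n + 1. (src j = x \<longrightarrow> s j = Some True) \<and> (dst j = x \<longrightarrow> s j = Some False))"
    using forward_in_pos backward_in_pos by blast
  finally show ?thesis by (simp add: is_source_def cycle_chord_board_def)
qed

text \<open>Treats both kinds of forbidden vertex at once: \<open>t = True\<close> describes a sink
  at \<open>x\<close>, \<open>t = False\<close> a source.\<close>

lemma monochromatic_iff:
  assumes "x \<le> n"
  shows "(\<forall>j\<le>n + 1. (src j = x \<longrightarrow> s j = Some (\<not> t)) \<and> (dst j = x \<longrightarrow> s j = Some t)) \<longleftrightarrow>
    (if x = 0 then s 0 = Some (\<not> t) \<and> s 1 = Some (\<not> t) \<and> s n = Some (\<not> t)
     else if x = 1 then s 0 = Some t \<and> s (n - 1) = Some t \<and> s (n + 1) = Some t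
     else if x = n then s n = Some t \<and> s (n + 1) = Some (\<not> t)
     else s (n - x) = Some t \<and> s (n + 1 - x) = Some (\<not> t))"
proof -
  have src: "src j = x \<longleftrightarrow> (if x = 0 then j = 0 \<or> j = 1 \<or> j = n else if x = 1 then False
     else if x = n then j = n + 1 else j = n + 1 - x)" if "j \<le> n + 1" for j
    using that assms n_ge_3 by - (rule index_cases[OF that], auto)
  have dst: "dst j = x \<longleftrightarrow> (if x = 0 then False else if x = 1 then j = 0 \<or> j = n - 1 \<or> j = n + 1
     else if x = n then j = n else j = n - x)" if "j \<le> n + 1" for j
    using that assms n_ge_3 by - (rule index_cases[OF that], auto)
  show ?thesis (is "?l \<longleftrightarrow> ?r")
  proof
    assume l: ?l
    have at: "src j = x \<Longrightarrow> s j = Some (\<not> t)" "dst j = x \<Longrightarrow> s j = Some t" if "j \<le> n + 1" for j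
      using l that by blast+
    consider "x = 0" | "x = 1" | "x = n" | "1 < x" "x < n" using assms by linarith
    then show ?r
    proof cases
      case 1
      then show ?thesis using at(1)[of 0] at(1)[of 1] at(1)[of n] n_ge_3 by simp
    next
      case 2
      then show ?thesis using at(2)[of 0] at(2)[of "n - 1"] at(2)[of "n + 1"] n_ge_3 by simp
    next
      case 3
      then show ?thesis using at(2)[of n] at(1)[of "n + 1"] n_ge_3 by simp
    next
      case 4
      then have "src (n + 1 - x) = x" "dst (n - x) = x" by auto
      then show ?thesis using 4 at(1)[of "n + 1 - x"] at(2)[of "n - x"] by simp
    qed
  next
    assume ?r
    then show ?l using assms n_ge_3 by (simp add: src dst split: if_splits)
  qed
qed

lemma ok_iff: "(\<forall>x. \<not> is_sink B (pos s) x \<and> \<not> is_source B (pos s) x) \<longleftrightarrow> ok s"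
proof
  let ?m = "\<lambda>x t. \<forall>j\<le>n + 1. (src j = x \<longrightarrow> s j = Some (\<not> t)) \<and> (dst j = x \<longrightarrow> s j = Some t)"
  have sink: "is_sink B (pos s) x \<longleftrightarrow> x \<le> n \<and> ?m x True" for x by (simp add: is_sink_pos)
  have source: "is_source B (pos s) x \<longleftrightarrow> x \<le> n \<and> ?m x False" for x by (simp add: is_source_pos)
  {
    assume "\<forall>x. \<not> is_sink B (pos s) x \<and> \<not> is_source B (pos s) x"
    then have *: "\<not> ?m x t" if "x \<le> n" for x t
      using that sink source by (cases t) metis+
    \<comment> \<open>The vertex shared by z_i and z_{i+1} is \<open>n - i\<close>.\<close>
    have "s (i + 1) \<noteq> Some (\<not> t)" if "1 \<le> i" "i + 1 < n" "s i = Some t" for i t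
    proof -
      have "n - i \<le> n" "n - i \<noteq> 0" "n - i \<noteq> 1" "n - i \<noteq> n" "n - (n - i) = i" "n + 1 - (n - i) = i + 1"
        using that by auto
      then show ?thesis using *[of "n - i" t] that(3) unfolding monochromatic_iff[OF \<open>n - i \<le> n\<close>] by simp
    qed
    moreover have "s (n + 1) \<noteq> Some (\<not> t)" if "s n = Some t" for t
      using *[of n t] that n_ge_3 unfolding monochromatic_iff[OF le_refl] by simp
    \<comment> \<open>All edges at 0 are oriented outwards, so the common sign \<open>t\<close>
      there corresponds to the negated parameter.\<close>
    moreover have "\<not> (s 0 = Some t \<and> s 1 = Some t \<and> s n = Some t)" for t
      using *[of 0 "\<not> t"] unfolding monochromatic_iff[OF le0] by simp
    moreover have "1 \<le> n" using n_ge_3 by simp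
    then have "\<not> (s 0 = Some t \<and> s (n - 1) = Some t \<and> s (n + 1) = Some t)" for t
      using *[of 1 t] unfolding monochromatic_iff[OF \<open>1 \<le> n\<close>] by simp
    ultimately show "ok s" unfolding ok_def by blast
  next
    assume ok: "ok s"
    have "\<not> ?m x t" if "x \<le> n" for x t
    proof -
      consider "x = 0" | "x = 1" | "x = n" | "1 < x" "x < n" using \<open>x \<le> n\<close> by linarith
      then show ?thesis
      proof cases
        case 4
        then have "1 \<le> n - x \<and> n - x + 1 < n" by auto
        then have "s (n - x) = Some t \<longrightarrow> s (n - x + 1) \<noteq> Some (\<not> t)"
          using ok unfolding ok_def by blast
        then show ?thesis using 4 monochromatic_iff[of x s t] by (auto simp: Suc_diff_le)
      qed (use ok monochromatic_iff[of x s t] n_ge_3 in \<open>auto simp: ok_def\<close>)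
    qed
    then show "\<forall>x. \<not> is_sink B (pos s) x \<and> \<not> is_source B (pos s) x"
      using sink source by blast
  }
qed

section \<open>Moves and cycle cells in terms of signs\<close>

lemma pos_update:
  assumes "j \<le> n + 1" "s j = None"
  shows "pos (s(j := Some t)) = insert (if t then (src j, dst j) else (dst j, src j)) (pos s)"
proof -
  have "(s(j := Some t)) i = Some b \<longleftrightarrow> i = j \<and> t = b \<or> s i = Some b" for i b
    using assms(2) by auto
  moreover have "{f i | i. i \<le> n + 1 \<and> (i = j \<and> b \<or> s i = c)} =
      (if b then insert (f j) {f i | i. i \<le> n + 1 \<and> s i = c} else {f i | i. i \<le> n + 1 \<and> s i = c})"
    for f :: "nat \<Rightarrow> nat \<times> nat" and b c
    using assms(1) by auto
  ultimately show ?thesis unfolding pos_def by simp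
qed

lemma legal_moves_pos:
  "legal_moves B (pos s) = {if t then (src j, dst j) else (dst j, src j) | j t. legal s j t}"
proof (intro equalityI subsetI)
  fix m assume m: "m \<in> legal_moves B (pos s)"
  obtain u v where uv: "m = (u, v)" by fastforce
  have l: "{u, v} \<in> edges B" "(u, v) \<notin> pos s" "(v, u) \<notin> pos s"
    "\<forall>x. \<not> is_sink B (insert m (pos s)) x \<and> \<not> is_source B (insert m (pos s)) x"
    using m uv by (auto simp: legal_moves_def)
  obtain j where j: "j \<le> n + 1" "{u, v} = {src j, dst j}" using l(1) by (auto simp: edges_B)
  obtain t where t: "m = (if t then (src j, dst j) else (dst j, src j))"
    using j uv by (fastforce simp: doubleton_eq_iff)
  have "(src j, dst j) \<notin> pos s \<and> (dst j, src j) \<notin> pos s"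
    using l t uv by (auto split: if_splits)
  then have "s j = None" using j(1)
    by (metis (full_types) forward_in_pos backward_in_pos not_None_eq)
  then have "legal s j t"
    using l(4) j(1) t pos_update[of j s t] ok_iff[of "s(j := Some t)"] by (simp add: legal_def)
  then show "m \<in> {if t then (src j, dst j) else (dst j, src j) | j t. legal s j t}" using t by blast
next
  fix m assume "m \<in> {if t then (src j, dst j) else (dst j, src j) | j t. legal s j t}"
  then obtain j t where m: "m = (if t then (src j, dst j) else (dst j, src j))" "legal s j t" by blast
  then have "j \<le> n + 1" "s j = None" "ok (s(j := Some t))" by (auto simp: legal_def)
  then show "m \<in> legal_moves B (pos s)"
    using m(1) pos_update[of j s t] ok_iff[of "s(j := Some t)"]
    by (auto simp: legal_moves_def edges_B forward_in_pos backward_in_pos insert_commute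
        split: if_splits)
qed

lemma triangle_iff: "is_cycle_cell (pos s) [n, 0, 1] \<longleftrightarrow>
    (\<exists>t. s n = Some t \<and> s (n + 1) = Some t \<and> s 0 = Some (\<not> t))"
proof -
  have arrows:
    "(0, 1) \<in> pos s \<longleftrightarrow> s 0 = Some True" "(1, 0) \<in> pos s \<longleftrightarrow> s 0 = Some False"
    "(0, n) \<in> pos s \<longleftrightarrow> s n = Some True" "(n, 0) \<in> pos s \<longleftrightarrow> s n = Some False"
    "(n, 1) \<in> pos s \<longleftrightarrow> s (n + 1) = Some True" "(1, n) \<in> pos s \<longleftrightarrow> s (n + 1) = Some False"
    using forward_in_pos[of 0 s] backward_in_pos[of 0 s] forward_in_pos[of n s] backward_in_pos[of n s]
      forward_in_pos[of "n + 1" s] backward_in_pos[of "n + 1" s] by simp_all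
  have all3: "(\<forall>i<length [n, 0, 1]. P i) \<longleftrightarrow> P 0 \<and> P 1 \<and> P 2" for P
    by (simp add: All_less_Suc numeral_2_eq_2 conj_ac)
  have "is_cycle_cell (pos s) [n, 0, 1] \<longleftrightarrow>
     ((n, 0) \<in> pos s \<and> (0, 1) \<in> pos s \<and> (1, n) \<in> pos s) \<or>
     ((0, n) \<in> pos s \<and> (1, 0) \<in> pos s \<and> (n, 1) \<in> pos s)"
    unfolding is_cycle_cell_def all3 by simp
  also have "\<dots> \<longleftrightarrow> (\<exists>t. s n = Some t \<and> s (n + 1) = Some t \<and> s 0 = Some (\<not> t))"
    unfolding arrows ex_bool_eq by (simp add: conj_ac disj_commute)
  finally show ?thesis .
qed

lemma long_cell_iff: "is_cycle_cell (pos s) (n # [1..<n] @ [0]) \<longleftrightarrow>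
    (\<exists>t. s n = Some t \<and> s (n + 1) = Some t \<and> (\<forall>i. 1 \<le> i \<and> i < n \<longrightarrow> s i = Some (\<not> t)))"
proof -
  let ?c = "n # [1..<n] @ [0]"
  have len: "length ?c = n + 1" using n_ge_3 by simp
  have nth: "?c ! i = (if i = 0 then n else if i < n then i else 0)" if "i \<le> n" for i
    using that n_ge_3 by (auto simp: nth_Cons' nth_append)
  \<comment> \<open>\<open>r i\<close> is the index of the edge that follows the \<open>i\<close>-th
    vertex on the boundary of the long cell: first y2, then z_{n-1} down to z_1, finally y1. This
    tour uses y2 and y1 along their orientation and the z edges against it.\<close>
  define r where "r i = (if i = 0 then n + 1 else if i = n then n else n - i)" for i
  have r: "r i \<le> n + 1" for i unfolding r_def by auto
  have ends: "(?c ! i, ?c ! ((i + 1) mod (n + 1))) =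
      (if 0 < i \<and> i < n then (dst (r i), src (r i)) else (src (r i), dst (r i)))"
    if i: "i \<le> n" for i
  proof -
    have m: "(i + 1) mod (n + 1) = (if i = n then 0 else i + 1)" using i by simp
    consider "i = 0" | "i = n" | "i + 1 = n" "0 < i" | "0 < i" "i + 1 < n" using i by linarith
    then show ?thesis
    proof cases
      case 3
      then have "i = n - 1" "r i = 1" by (auto simp: r_def)
      then show ?thesis using 3 n_ge_3 nth[of i] nth[of "i + 1"] m by simp
    qed (use n_ge_3 nth[of i] nth[of "i + 1"] nth[of 0] m in \<open>auto simp: r_def\<close>)
  qed
  have mem: "((?c ! i, ?c ! ((i + 1) mod (n + 1))) \<in> pos s \<longleftrightarrow>
       s (r i) = Some (\<not> (0 < i \<and> i < n))) \<and>
     ((?c ! ((i + 1) mod (n + 1)), ?c ! i) \<in> pos s \<longleftrightarrow> s (r i) = Some (0 < i \<and> i < n))"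
    if "i \<le> n" for i
    using ends[OF that] forward_in_pos[OF r, of i s] backward_in_pos[OF r, of i s]
    by (auto split: if_splits)
  \<comment> \<open>The inequality of truth values is an exclusive or: sign \<open>t\<close> on the
    two y edges and the opposite on the z edges. The two values of \<open>t\<close> are the two
    directions of the tour.\<close>
  have all: "(\<forall>i<n + 1. s (r i) = Some (t \<noteq> (0 < i \<and> i < n))) \<longleftrightarrow>
     s n = Some t \<and> s (n + 1) = Some t \<and> (\<forall>i. 1 \<le> i \<and> i < n \<longrightarrow> s i = Some (\<not> t))" (is "?l \<longleftrightarrow> ?r") for t
  proof
    assume l: ?l
    have "s i = Some (\<not> t)" if "1 \<le> i" "i < n" for i
    proof -
      have "n - i < n + 1" "n - i \<noteq> 0" "n - i < n" "r (n - i) = i" using that by (auto simp: r_def)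
      then show ?thesis using l[rule_format, of "n - i"] by simp
    qed
    then show ?r using l[rule_format, of 0] l[rule_format, of n] n_ge_3 by (simp add: r_def)
  next
    assume ?r
    then show ?l using n_ge_3 by (auto simp: r_def)
  qed
  have "is_cycle_cell (pos s) ?c \<longleftrightarrow>
     (\<forall>i<n + 1. s (r i) = Some (True \<noteq> (0 < i \<and> i < n))) \<or>
     (\<forall>i<n + 1. s (r i) = Some (False \<noteq> (0 < i \<and> i < n)))"
    unfolding is_cycle_cell_def len
  proof (intro arg_cong2[where f = "(\<or>)"] all_cong)
    fix i assume "i < n + 1"
    then have i: "i \<le> n" by simp
    show "(?c ! i, ?c ! ((i + 1) mod (n + 1))) \<in> pos s \<longleftrightarrow> s (r i) = Some (True \<noteq> (0 < i \<and> i < n))"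
      using mem[OF i] by (simp only: simp_thms)
    show "(?c ! ((i + 1) mod (n + 1)), ?c ! i) \<in> pos s \<longleftrightarrow> s (r i) = Some (False \<noteq> (0 < i \<and> i < n))"
      using mem[OF i] by (simp only: simp_thms)
  qed
  also have "\<dots> \<longleftrightarrow> (\<exists>t. s n = Some t \<and> s (n + 1) = Some t \<and>
      (\<forall>i. 1 \<le> i \<and> i < n \<longrightarrow> s i = Some (\<not> t)))"
    by (simp only: all ex_bool_eq)
  finally show ?thesis .
qed

lemma has_cycle_cell_pos: "has_cycle_cell B (pos s) \<longleftrightarrow> cell s"
  using triangle_iff[of s] long_cell_iff[of s]
  unfolding has_cycle_cell_def cell_def by (auto simp: cycle_chord_board_def)

section \<open>The game on sign assignments\<close>

fun wins :: "nat \<Rightarrow> (nat \<Rightarrow> bool option) \<Rightarrow> bool" where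
  "wins 0 s = False"
| "wins (Suc k) s = (\<exists>j t. legal s j t \<and> (cell (s(j := Some t)) \<or> \<not> wins k (s(j := Some t))))"

lemma insert_move_pos:
  "legal s j t \<Longrightarrow> insert (if t then (src j, dst j) else (dst j, src j)) (pos s) = pos (s(j := Some t))"
  by (simp add: legal_def pos_update)

lemma mover_wins_fuel_pos: "mover_wins_fuel B k (pos s) \<longleftrightarrow> wins k s"
proof (induction k arbitrary: s)
  case (Suc k)
  have "mover_wins_fuel B (Suc k) (pos s) \<longleftrightarrow>
     (\<exists>j t. legal s j t \<and> (let M = insert (if t then (src j, dst j) else (dst j, src j)) (pos s)
        in has_cycle_cell B M \<or> \<not> mover_wins_fuel B k M))"
    by (simp only: mover_wins_fuel.simps legal_moves_pos Let_def) blast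
  also have "\<dots> \<longleftrightarrow> wins (Suc k) s"
    by (simp add: Let_def insert_move_pos has_cycle_cell_pos Suc.IH del: fun_upd_apply cong: conj_cong)
  finally show ?case .
qed simp

text \<open>Dead edges are counted too. Thus the count drops by exactly one per move: it bounds the
  remaining length of the game, and its parity records whose turn it is.\<close>

definition free :: "(nat \<Rightarrow> bool option) \<Rightarrow> nat" where
  "free s = card {j. j \<le> n + 1 \<and> s j = None}"

lemma free_update:
  assumes "legal s j t"
  shows "free s = Suc (free (s(j := Some t)))"
proof -
  have "{i. i \<le> n + 1 \<and> s i = None} = insert j {i. i \<le> n + 1 \<and> (s(j := Some t)) i = None}"
    using assms by (auto simp: legal_def)
  then show ?thesis unfolding free_def by simp
qed

text \<open>\<open>P\<close> is an invariant of the player who has just moved. That player can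
  always reply, so never runs out of moves first, and the opponent never completes a cell.\<close>

lemma losing_strategy:
  assumes answer: "\<And>s j t. P s \<Longrightarrow> legal s j t \<Longrightarrow> \<not> cell (s(j := Some t)) \<and>
      (\<exists>i u. legal (s(j := Some t)) i u \<and>
         (cell (s(j := Some t, i := Some u)) \<or> P (s(j := Some t, i := Some u))))"
  shows "P s \<Longrightarrow> free s \<le> k \<Longrightarrow> \<not> wins k s"
proof (induction k arbitrary: s rule: less_induct)
  case (less k)
  show ?case
  proof
    assume "wins k s"
    then obtain k' j t where k: "k = Suc k'" and l: "legal s j t"
      and w: "cell (s(j := Some t)) \<or> \<not> wins k' (s(j := Some t))"
      by (cases k) auto
    from answer[OF less.prems(1) l] obtain i u where nc: "\<not> cell (s(j := Some t))"
      and l': "legal (s(j := Some t)) i u"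
      and c: "cell (s(j := Some t, i := Some u)) \<or> P (s(j := Some t, i := Some u))" by blast
    \<comment> \<open>A round uses two edges, so the fuel bound leaves at least one unit for the
      reply; otherwise \<open>wins 0\<close> would falsely count the replying player as
      lost.\<close>
    have f: "free s = Suc (Suc (free (s(j := Some t, i := Some u))))"
      using free_update[OF l] free_update[OF l'] by simp
    then obtain k'' where k'': "k' = Suc k''" using less.prems(2) k by (cases k') auto
    have "cell (s(j := Some t, i := Some u)) \<or> \<not> wins k'' (s(j := Some t, i := Some u))"
      using c less.IH[of k''] k k'' f less.prems(2) by auto
    then have "wins k' (s(j := Some t))" unfolding k'' using l' by auto
    then show False using w nc by blast
  qed
qed

section \<open>The reflection exchanging the vertices 0 and 1 and fixing the vertex
  \<open>n\<close>\<close>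

definition mir :: "nat \<Rightarrow> nat" where
  "mir j = (if 1 \<le> j \<and> j < n then n - j else if j = n then n + 1 else if j = n + 1 then n else j)"

lemma mir_simps [simp]:
  "mir 0 = 0" "mir n = Suc n" "mir (Suc n) = n" "1 \<le> j \<Longrightarrow> j < n \<Longrightarrow> mir j = n - j"
  using n_ge_3 by (auto simp: mir_def)

lemma mir_mir [simp]: "mir (mir j) = j"
  using n_ge_3 by (auto simp: mir_def)

lemma mir_eq_iff: "mir i = j \<longleftrightarrow> i = mir j"
  by (metis mir_mir)

lemma mir_le_iff [simp]: "mir j \<le> Suc n \<longleftrightarrow> j \<le> Suc n"
  unfolding mir_def by auto

lemma comp_mir_update: "s(j := x) \<circ> mir = (s \<circ> mir)(mir j := x)"
  by (auto simp: fun_eq_iff mir_eq_iff)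

lemma comp_mir_mir [simp]: "s \<circ> mir \<circ> mir = s"
  by (simp add: fun_eq_iff)

lemma ok_path:
  assumes "ok s" "1 \<le> i" "i + 1 < n" "s i = Some t"
  shows "s (i + 1) \<noteq> Some (\<not> t)"
  using assms unfolding ok_def by blast

lemma ok_mir: "ok (s \<circ> mir) \<longleftrightarrow> ok s"
proof -
  have imp: "ok (s \<circ> mir)" if ok: "ok s" for s
    unfolding ok_def
  proof (intro conjI allI impI, goal_cases)
    case (1 i t)
    have m: "mir i = n - i" "mir (i + 1) = n - (i + 1)" using 1 by auto
    \<comment> \<open>Reflection reverses the order of two consecutive z edges, so the path rule is
      used in contrapositive form, with the opposite sign.\<close>
    have "1 \<le> n - (i + 1)" "n - (i + 1) + 1 = n - i" "n - (i + 1) + 1 < n" using 1 by auto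
    then have "s (n - (i + 1)) \<noteq> Some (\<not> t)"
      using ok_path[OF ok, of "n - (i + 1)" "\<not> t"] 1 m by auto
    then show ?case unfolding comp_apply m(2) .
  next
    case (2 t)
    then show ?case using ok unfolding ok_def by auto
  next
    case (3 t)
    have "mir 1 = n - 1" using n_ge_3 by auto
    then show ?case using ok unfolding ok_def by auto
  next
    case (4 t)
    have "mir (n - 1) = 1" using n_ge_3 by auto
    then show ?case using ok unfolding ok_def by auto
  qed
  show ?thesis using imp[of s] imp[of "s \<circ> mir"] by auto
qed

lemma cell_mir: "cell (s \<circ> mir) \<longleftrightarrow> cell s"
proof -
  have imp: "cell (s \<circ> mir)" if c: "cell s" for s
  proof -
    obtain t where t: "s n = Some t" "s (n + 1) = Some t"
      "s 0 = Some (\<not> t) \<or> (\<forall>i. 1 \<le> i \<and> i < n \<longrightarrow> s i = Some (\<not> t))"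
      using c unfolding cell_def by blast
    then have "s 0 = Some (\<not> t) \<or> (\<forall>i. 1 \<le> i \<and> i < n \<longrightarrow> (s \<circ> mir) i = Some (\<not> t))"
      by auto
    then show ?thesis using t unfolding cell_def by auto
  qed
  show ?thesis using imp[of s] imp[of "s \<circ> mir"] by auto
qed

lemma legal_mir: "legal (s \<circ> mir) j t \<longleftrightarrow> legal s (mir j) t"
proof -
  have "(s \<circ> mir)(j := Some t) = s(mir j := Some t) \<circ> mir" by (simp add: comp_mir_update)
  then show ?thesis by (simp add: legal_def ok_mir del: fun_upd_apply)
qed

lemma free_mir: "free (s \<circ> mir) = free s"
proof -
  have "{j. j \<le> n + 1 \<and> (s \<circ> mir) j = None} = mir ` {j. j \<le> n + 1 \<and> s j = None}"
    by (auto simp: image_iff) (metis mir_mir mir_le_iff)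
  moreover have "inj mir" by (metis injI mir_mir)
  ultimately show ?thesis
    by (simp add: free_def card_image inj_on_subset[OF \<open>inj mir\<close>])
qed

section \<open>Legality of a single mark and parity on exhausted paths\<close>

lemma ok_path_iff:
  assumes "ok s" "s i = None" "1 \<le> i" "i < n"
  shows "ok (s(i := Some u)) \<longleftrightarrow>
    (1 < i \<longrightarrow> s (i - 1) \<noteq> Some (\<not> u)) \<and> (i + 1 < n \<longrightarrow> s (i + 1) \<noteq> Some (\<not> u)) \<and>
    (i = 1 \<longrightarrow> \<not> (s 0 = Some u \<and> s n = Some u)) \<and>
    (i = n - 1 \<longrightarrow> \<not> (s 0 = Some u \<and> s (n + 1) = Some u))" (is "?l \<longleftrightarrow> ?r")
proof
  let ?s = "s(i := Some u)"
  assume ok: ?l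
  have "s (i - 1) \<noteq> Some (\<not> u)" if "1 < i"
  proof -
    have "1 \<le> i - 1" "i - 1 \<noteq> i" "i - 1 + 1 = i" using that by auto
    then show ?thesis using ok_path[OF ok, of "i - 1" "\<not> u"] assms(4) by auto
  qed
  moreover have "s (i + 1) \<noteq> Some (\<not> u)" if "i + 1 < n"
    using ok_path[OF ok, of i u] that assms by auto
  moreover have "\<not> (?s 0 = Some u \<and> ?s 1 = Some u \<and> ?s n = Some u)"
    "\<not> (?s 0 = Some u \<and> ?s (n - 1) = Some u \<and> ?s (n + 1) = Some u)"
    using ok unfolding ok_def by blast+
  ultimately show ?r using assms n_ge_3 by auto
next
  assume r: ?r
  show ?l
    unfolding ok_def
  proof (intro conjI allI impI, goal_cases)
    case (1 k t)
    then show ?case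
      using r ok_path[OF assms(1), of k t] assms by (cases "k = i"; cases "k + 1 = i") auto
  next
    case (2 t)
    then show ?case using assms unfolding ok_def by auto
  next
    case (3 t)
    then show ?case using r assms n_ge_3 unfolding ok_def by auto
  next
    case (4 t)
    then show ?case using r assms n_ge_3 unfolding ok_def by auto
  qed
qed

lemma ok_update_0:
  assumes "ok s" "\<not> (s 1 = Some u \<and> s n = Some u)" "\<not> (s (n - 1) = Some u \<and> s (n + 1) = Some u)"
  shows "ok (s(0 := Some u))"
  using assms n_ge_3 unfolding ok_def by auto

lemma ok_update_last:
  assumes "ok s" "s n \<noteq> Some (\<not> u)" "\<not> (s 0 = Some u \<and> s (n - 1) = Some u)"
  shows "ok (s(n + 1 := Some u))"
  using assms n_ge_3 unfolding ok_def by auto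

text \<open>The path is shortened from its far end. A marked position \<open>m - 1\<close> carries
  the same sign as \<open>m\<close> and can replace it; an unmarked one is a sign change preceded by
  a marked position, so dropping two positions flips both sides of the equivalence.\<close>

lemma path_parity:
  fixes f :: "nat \<Rightarrow> bool option"
  assumes "f 0 = Some a" "f m = Some b"
    and "\<And>i t. i < m \<Longrightarrow> f i = Some t \<Longrightarrow> f (Suc i) \<noteq> Some (\<not> t)"
    and "\<And>i. i < m \<Longrightarrow> f i = None \<Longrightarrow> \<exists>t. f (i - 1) = Some t \<and> f (Suc i) = Some (\<not> t)"
  shows "even (card {i. i < m \<and> f i = None}) \<longleftrightarrow> a = b"
  using assms
proof (induction m arbitrary: b rule: less_induct)
  case (less m)
  show ?case
  proof (cases m)
    case 0
    then show ?thesis using less.prems by simp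
  next
    case (Suc m')
    show ?thesis
    proof (cases "f m'")
      case (Some c)
      then have "c = b" using less.prems(2) less.prems(3)[of m' c] Suc by auto
      moreover have "{i. i < m \<and> f i = None} = {i. i < m' \<and> f i = None}"
        using Some Suc by (auto simp: less_Suc_eq)
      ultimately show ?thesis
        using less.IH[of m' c] Some Suc less.prems(1,3,4) by simp
    next
      case None
      then obtain m'' where m'': "m' = Suc m''" using less.prems(1) by (cases m') auto
      obtain t where t: "f m'' = Some t" "f m = Some (\<not> t)"
        using less.prems(4)[of m'] None Suc m'' by auto
      have "{i. i < m \<and> f i = None} = insert m' {i. i < m'' \<and> f i = None}"
        using None t Suc m'' by (auto simp: less_Suc_eq)
      moreover have "b = (\<not> t)" using t less.prems(2) by simp
      moreover have "m' \<notin> {i. i < m'' \<and> f i = None}" using m'' by simp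
      moreover have "even (card {i. i < m'' \<and> f i = None}) \<longleftrightarrow> a = t"
        using less.IH[of m'' t] t Suc m'' less.prems(1,3,4) by simp
      ultimately show ?thesis by auto
    qed
  qed
qed

text \<open>An unmarked first edge of the z path is blocked in one direction by x and y1; this acts like a
marked edge of sign a preceding it.\<close>

lemma path_exhausted_parity:
  assumes ok: "ok s" and b: "s (n - 1) = Some b"
    and a: "s 1 \<noteq> Some (\<not> a)" "s 1 = None \<Longrightarrow> s 0 = Some (\<not> a) \<and> s n = Some (\<not> a)"
    and stuck: "\<And>i u. 1 \<le> i \<Longrightarrow> i < n \<Longrightarrow> \<not> legal s i u"
  shows "even (card {i. 1 \<le> i \<and> i < n \<and> s i = None}) \<longleftrightarrow> a = b"
proof -
  \<comment> \<open>Position 0 is the virtual edge of sign \<open>a\<close> in front of z_1.\<close>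
  define f where "f i = (if i = 0 then Some a else s i)" for i
  have "even (card {i. i < n - 1 \<and> f i = None}) \<longleftrightarrow> a = b"
  proof (rule path_parity)
    show "f 0 = Some a" "f (n - 1) = Some b" using b n_ge_3 by (auto simp: f_def)
    show "f (Suc i) \<noteq> Some (\<not> t)" if "i < n - 1" "f i = Some t" for i t
      using that a(1) ok_path[OF ok, of i t] by (cases "i = 0") (auto simp: f_def)
    show "\<exists>t. f (i - 1) = Some t \<and> f (Suc i) = Some (\<not> t)" if "i < n - 1" "f i = None" for i
    proof -
      have i: "1 \<le> i" "i < n" "s i = None" "i \<noteq> n - 1" "i + 1 < n"
        using that by (auto simp: f_def split: if_splits)
      have blocked: "(1 < i \<and> s (i - 1) = Some (\<not> u)) \<or> s (i + 1) = Some (\<not> u) \<or>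
          (i = 1 \<and> s 0 = Some u \<and> s n = Some u)" for u
        using stuck[OF i(1,2), of u] ok_path_iff[OF ok i(3,1,2), of u] i by (auto simp: legal_def)
      show ?thesis
      proof (cases "i = 1")
        case True
        \<comment> \<open>If z_1 is unmarked, x and y1 forbid only the opposite of \<open>a\<close>.
          What forbids \<open>a\<close> itself must then be the opposite sign on z_2.\<close>
        then have "f (i - 1) = Some a" "f (Suc i) = s (i + 1)" by (auto simp: f_def)
        then show ?thesis using blocked[of a] a(2) i True by auto
      next
        case False
        then have f: "f (i - 1) = s (i - 1)" "f (Suc i) = s (i + 1)" using i by (auto simp: f_def)
        show ?thesis using blocked[of True] blocked[of False] False unfolding f
          by (auto simp: ex_bool_eq)
      qed
    qed
  qed
  moreover have "i < n - 1 \<and> f i = None \<longleftrightarrow> 1 \<le> i \<and> i < n \<and> s i = None" for i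
  proof -
    have "i < n - 1 \<longleftrightarrow> i < n \<and> i \<noteq> n - 1" by auto
    then show ?thesis using b by (auto simp: f_def)
  qed
  ultimately show ?thesis by simp
qed

lemma ok_update_first:
  assumes "ok s" "s (n + 1) \<noteq> Some (\<not> u)" "\<not> (s 0 = Some u \<and> s 1 = Some u)"
  shows "ok (s(n := Some u))"
  using assms n_ge_3 unfolding ok_def by auto

subsection \<open>Positions lost for the player to move\<close>

text \<open>Since the self-mirrored edges are already marked, every move has its mirror image on a
  different, still unmarked edge.\<close>

definition mirrored :: "(nat \<Rightarrow> bool option) \<Rightarrow> bool" where
  "mirrored s \<longleftrightarrow> ok s \<and> s \<circ> mir = s \<and> (\<forall>j\<le>n + 1. mir j = j \<longrightarrow> s j \<noteq> None)"

text \<open>The remaining four kinds of positions occur only for even n.  Symmetry forces y2 to be unmarked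
here, as y1 is.\<close>

definition unbroken :: "(nat \<Rightarrow> bool option) \<Rightarrow> bool" where
  "unbroken s \<longleftrightarrow> even n \<and> ok s \<and> s \<circ> mir = s \<and> s 0 = None \<and> s n = None \<and> s (n div 2) = None"

text \<open>After y1 was answered by x with the same sign.\<close>

definition guarded :: "(nat \<Rightarrow> bool option) \<Rightarrow> bool" where
  "guarded s \<longleftrightarrow> even n \<and> ok s \<and> (\<forall>j. 1 \<le> j \<and> j < n \<longrightarrow> s (n - j) = s j) \<and>
     s (n div 2) = None \<and> s (n + 1) = None \<and> (\<exists>t. s 0 = Some t \<and> s n = Some t)"

text \<open>Here y2 can never be marked, so neither cell can be completed.\<close>

definition sealed :: "(nat \<Rightarrow> bool option) \<Rightarrow> bool" where
  "sealed s \<longleftrightarrow> ok s \<and> s (n + 1) = None \<and> (\<exists>t. s 0 = Some t \<and> s n = Some t \<and> s (n - 1) = Some t)"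

text \<open>A mark on x or on y2 is answered by the other one, completing the triangle.\<close>

definition poisoned :: "(nat \<Rightarrow> bool option) \<Rightarrow> bool" where
  "poisoned s \<longleftrightarrow> ok s \<and> s 0 = None \<and> s (n + 1) = None \<and>
     (\<exists>t. s n = Some t \<and> s 1 = Some t \<and> s (n - 1) = Some t)"

definition good :: "(nat \<Rightarrow> bool option) \<Rightarrow> bool" where
  "good s \<longleftrightarrow> mirrored s \<or> unbroken s \<or> guarded s \<or> sealed s \<or> poisoned s"

text \<open>Reflection is allowed here because \<open>guarded\<close>, \<open>sealed\<close> and
  \<open>poisoned\<close> are formulated only for y1 marked; the versions with y2 marked are their
  mirror images.\<close>

definition answerable :: "(nat \<Rightarrow> bool option) \<Rightarrow> bool" where
  "answerable s \<longleftrightarrow> (\<exists>i u. legal s i u \<and>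
     (cell (s(i := Some u)) \<or> good (s(i := Some u)) \<or> good (s(i := Some u) \<circ> mir)))"

lemma answerableI:
  assumes "legal s i u" "cell (s(i := Some u)) \<or> good (s(i := Some u))"
  shows "answerable s"
  using assms unfolding answerable_def by blast

lemma answerable_mir: "answerable (s \<circ> mir) \<longleftrightarrow> answerable s"
proof -
  have imp: "answerable s" if a: "answerable (s \<circ> mir)" for s
  proof -
    obtain i u where l: "legal (s \<circ> mir) i u" and g: "cell ((s \<circ> mir)(i := Some u)) \<or>
        good ((s \<circ> mir)(i := Some u)) \<or> good ((s \<circ> mir)(i := Some u) \<circ> mir)"
      using a unfolding answerable_def by blast
    have e: "(s \<circ> mir)(i := Some u) = s(mir i := Some u) \<circ> mir" by (simp add: comp_mir_update)
    show ?thesis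
      using l g unfolding e legal_mir cell_mir comp_mir_mir answerable_def by blast
  qed
  show ?thesis using imp[of s] imp[of "s \<circ> mir"] by auto
qed

section \<open>Symmetric positions and mirror replies\<close>

lemma symmetric_path:
  assumes "s \<circ> mir = s" "1 \<le> j" "j < n"
  shows "s (n - j) = s j"
  using fun_cong[OF assms(1), of j, unfolded comp_apply] assms(2,3) by simp

lemma symmetric_triangle:
  assumes "s \<circ> mir = s"
  shows "s (n + 1) = s n"
  using fun_cong[OF assms, of n] by simp

lemma symmetric_update:
  assumes "s \<circ> mir = s"
  shows "s(j := x, mir j := x) \<circ> mir = s(j := x, mir j := x)"
  using assms by (auto simp: fun_eq_iff mir_eq_iff)

lemma symmetric_update_fixed:
  assumes "s \<circ> mir = s" "mir j = j"
  shows "s(j := x) \<circ> mir = s(j := x)"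
  using symmetric_update[OF assms(1), of j x] assms(2) by simp

text \<open>A neighbour of z_{n-j} on the path is either z_j itself, which carries \<open>t\<close>,
  or the mirror image of a neighbour of z_j, which is compatible with \<open>t\<close> because the
  mark on z_j was. Only the vertices 0 and 1 need separate hypotheses.\<close>

lemma ok_mirror_path:
  assumes sym: "\<And>i. 1 \<le> i \<Longrightarrow> i < n \<Longrightarrow> s (n - i) = s i"
    and j: "1 \<le> j" "j < n" "n - j \<noteq> j" and none: "s j = None" and ok: "ok (s(j := Some t))"
    and b: "n - j = 1 \<Longrightarrow> \<not> (s 0 = Some t \<and> s n = Some t)"
    and c: "n - j = n - 1 \<Longrightarrow> \<not> (s 0 = Some t \<and> s (n + 1) = Some t)"
  shows "ok (s(j := Some t, n - j := Some t))"
proof -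
  let ?s = "s(j := Some t)" and ?k = "n - j"
  have k: "1 \<le> ?k" "?k < n" "?s ?k = None" using j none sym[of j] by auto
  have "?s (?k - 1) \<noteq> Some (\<not> t)" if "1 < ?k"
  proof (cases "?k - 1 = j")
    case False
    have "?k - 1 = n - (j + 1)" "j + 1 < n" using that j by auto
    then have "?s (?k - 1) = s (j + 1)" using False sym[of "j + 1"] by auto
    then show ?thesis using ok_path[OF ok, of j t] j \<open>j + 1 < n\<close> by auto
  qed auto
  moreover have "?s (?k + 1) \<noteq> Some (\<not> t)" if "?k + 1 < n"
  proof (cases "?k + 1 = j")
    case False
    have *: "?k + 1 = n - (j - 1)" "1 \<le> j - 1" "j - 1 < n" "j - 1 \<noteq> j" "j - 1 + 1 = j"
      using that j by auto
    then have "?s (?k + 1) = s (j - 1)" using False sym[of "j - 1"] by auto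
    then show ?thesis using ok_path[OF ok, of "j - 1" "\<not> t"] j * by auto
  qed auto
  moreover have "?s 0 = s 0" "?s n = s n" "?s (n + 1) = s (n + 1)" using j by auto
  ultimately show ?thesis using b c by (subst ok_path_iff[OF ok k(3,1,2)]) auto
qed

text \<open>The boundary of each cell is symmetric. A cell through the new mark would also contain
  its mirror image, which is unmarked, so the completed cell was there before.\<close>

lemma cell_update_symmetric:
  assumes sym: "s \<circ> mir = s" and j: "s j = None" "mir j \<noteq> j" and cell: "cell (s(j := Some t))"
  shows "cell s"
proof -
  let ?s = "s(j := Some t)"
  have m: "?s (mir j) = None" using j fun_cong[OF sym, of j] by auto
  obtain u where u: "?s n = Some u" "?s (n + 1) = Some u"
    "?s 0 = Some (\<not> u) \<or> (\<forall>i. 1 \<le> i \<and> i < n \<longrightarrow> ?s i = Some (\<not> u))"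
    using cell unfolding cell_def by blast
  have "j \<noteq> 0" using j(2) by (cases "j = 0") auto
  moreover have "j \<noteq> n" using m u by auto
  moreover have "j \<noteq> n + 1" using m u by auto
  ultimately have "s n = Some u" "s (n + 1) = Some u" "?s 0 = s 0" using u by simp_all
  moreover have "s i = Some (\<not> u)" if "\<forall>i. 1 \<le> i \<and> i < n \<longrightarrow> ?s i = Some (\<not> u)" "1 \<le> i" "i < n" for i
  proof (cases "i = j")
    case True
    then have "1 \<le> mir j" "mir j < n" using that by auto
    then show ?thesis using that(1) m by auto
  qed (use that in auto)
  ultimately show ?thesis using u(3) unfolding cell_def by metis
qed

text \<open>By symmetry, what could forbid the reply at one of the vertices 0 and 1 would already
  have forbidden the original move at the other.\<close>

lemma symmetric_mirror_reply:
  assumes sym: "s \<circ> mir = s" and l: "legal s j t" and j: "mir j \<noteq> j"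
  shows "legal (s(j := Some t)) (mir j) t"
proof -
  have ok: "ok (s(j := Some t))" and none: "s j = None" and le: "j \<le> n + 1"
    using l by (auto simp: legal_def)
  have tri: "s (n + 1) = s n" by (rule symmetric_triangle[OF sym])
  have path: "s (n - i) = s i" if "1 \<le> i" "i < n" for i by (rule symmetric_path[OF sym that])
  have ne: "n - Suc 0 \<noteq> n" "n - Suc 0 \<noteq> Suc n" using n_ge_3 by auto
  have p1: "s (n - 1) = s 1" using path[of 1] n_ge_3 by simp
  have not_both: "\<not> (s(j := Some t)) 0 = Some u \<or> \<not> (s(j := Some t)) 1 = Some u \<or> \<not> (s(j := Some t)) n = Some u"
    "\<not> (s(j := Some t)) 0 = Some u \<or> \<not> (s(j := Some t)) (n - 1) = Some u \<or> \<not> (s(j := Some t)) (n + 1) = Some u" for u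
    using ok unfolding ok_def by blast+
  have "ok (s(j := Some t, mir j := Some t))"
  proof (cases "1 \<le> j \<and> j < n")
    case True
    then have m: "mir j = n - j" by simp
    have "ok (s(j := Some t, n - j := Some t))"
    proof (rule ok_mirror_path)
      show "\<not> (s 0 = Some t \<and> s n = Some t)" if "n - j = 1"
        using that not_both(2)[of t] True tri n_ge_3 by auto
      show "\<not> (s 0 = Some t \<and> s (n + 1) = Some t)" if "n - j = n - 1"
      proof -
        have "j = 1" using that True by linarith
        then show ?thesis using not_both(1)[of t] tri n_ge_3 by auto
      qed
    qed (use True j m none ok path in \<open>auto simp del: fun_upd_apply\<close>)
    then show ?thesis by (simp add: m)
  next
    case False
    moreover have "j \<noteq> 0" using j by (cases "j = 0") auto
    ultimately consider "j = n" | "j = n + 1" using le by linarith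
    then show ?thesis
    proof cases
      case 1
      have "ok (s(j := Some t, n + 1 := Some t))"
        by (rule ok_update_last[OF ok]) (use not_both(1)[of t] p1 n_ge_3 ne 1 in auto)
      then show ?thesis using 1 by simp
    next
      case 2
      have "ok (s(j := Some t, n := Some t))"
        by (rule ok_update_first[OF ok]) (use not_both(2)[of t] p1 n_ge_3 ne 2 in auto)
      then show ?thesis using 2 by simp
    qed
  qed
  moreover have "(s(j := Some t)) (mir j) = None" using none j fun_cong[OF sym, of j] by auto
  moreover have "mir j \<le> n + 1" using le by simp
  ultimately show ?thesis by (simp add: legal_def del: fun_upd_apply)
qed

lemma mirrored_answerable:
  assumes s: "mirrored s" and l: "legal s j t" and "\<not> cell s"
  shows "\<not> cell (s(j := Some t)) \<and> answerable (s(j := Some t))"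
proof -
  have sym: "s \<circ> mir = s" and fixed: "\<And>i. i \<le> n + 1 \<Longrightarrow> mir i = i \<Longrightarrow> s i \<noteq> None"
    using s by (auto simp: mirrored_def)
  have none: "s j = None" and le: "j \<le> n + 1" using l by (auto simp: legal_def)
  have j: "mir j \<noteq> j" using fixed none le by blast
  note reply = symmetric_mirror_reply[OF sym l j]
  have "mirrored (s(j := Some t, mir j := Some t))"
    using reply fixed symmetric_update[OF sym] unfolding mirrored_def legal_def by auto
  then have "answerable (s(j := Some t))" using reply unfolding answerable_def good_def by blast
  moreover have "\<not> cell (s(j := Some t))" using cell_update_symmetric[OF sym none j] assms(3) by blast
  ultimately show ?thesis by blast
qed

lemma mir_fixed:
  assumes "even n" "mir j = j" "j \<le> n + 1"
  shows "j = 0 \<or> j = n div 2"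
proof (cases "1 \<le> j \<and> j < n")
  case True
  then have "n = 2 * j" using assms(2) by simp
  then show ?thesis by simp
next
  case False
  then have "j = 0 \<or> j = n \<or> j = n + 1" using assms(3) by linarith
  then show ?thesis using assms(2) by (elim disjE) simp_all
qed

lemma middle:
  assumes "even n"
  shows "2 \<le> n div 2" "n div 2 + 1 < n" "n - n div 2 = n div 2" "n div 2 \<noteq> n" "n div 2 \<noteq> n - 1"
    "mir (n div 2) = n div 2"
proof -
  obtain m where m: "n = 2 * m" using assms by blast
  show "2 \<le> n div 2" "n div 2 + 1 < n" "n - n div 2 = n div 2" "n div 2 \<noteq> n" "n div 2 \<noteq> n - 1"
    using n_ge_3 m by auto
  then show "mir (n div 2) = n div 2" by simp
qed

text \<open>The two neighbours of the middle edge are mirror images, hence equal: their sign, or any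
  sign if they are unmarked, fits. For even \<open>n\<close> the middle edge touches neither 0 nor
  1.\<close>

lemma ok_update_middle:
  assumes n: "even n" and ok: "ok s" and none: "s (n div 2) = None"
    and sym: "\<And>i. 1 \<le> i \<Longrightarrow> i < n \<Longrightarrow> s (n - i) = s i"
  obtains u where "ok (s(n div 2 := Some u))"
proof -
  define h where "h = n div 2"
  note h = middle[OF n, folded h_def] and none = none[folded h_def]
  have e: "s (h + 1) = s (h - 1)"
  proof -
    have "n - (h - 1) = h + 1" using h(1-3) by linarith
    moreover have "1 \<le> h - 1" "h - 1 < n" using h(1,2) by linarith+
    ultimately show ?thesis using sym[of "h - 1"] by simp
  qed
  obtain u where "s (h - 1) \<noteq> Some (\<not> u)" by (cases "s (h - 1)") auto
  moreover have "1 \<le> h" "h < n" "h \<noteq> 1" using h(1,2) by auto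
  ultimately have "ok (s(h := Some u))"
    using ok_path_iff[OF ok none, of u] e h(5) by simp
  then show ?thesis using that unfolding h_def by blast
qed

lemma mirroredI:
  assumes "even n" "ok s" "s \<circ> mir = s" "s 0 \<noteq> None" "s (n div 2) \<noteq> None"
  shows "mirrored s"
  unfolding mirrored_def
proof (intro conjI allI impI)
  show "s j \<noteq> None" if "j \<le> n + 1" "mir j = j" for j
    using mir_fixed[OF assms(1) that(2,1)] assms(4,5) by (elim disjE) simp_all
qed (use assms in simp_all)

lemma symmetricI:
  assumes "\<And>j. 1 \<le> j \<Longrightarrow> j < n \<Longrightarrow> s (n - j) = s j" "s (n + 1) = s n"
  shows "s \<circ> mir = s"
proof
  show "(s \<circ> mir) j = s j" for j
    using assms unfolding mir_def by simp
qed

section \<open>Answers in the remaining kinds of positions\<close>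

lemma free_split:
  assumes "s n \<noteq> None"
  shows "free s = card {i. 1 \<le> i \<and> i < n \<and> s i = None} + card {i \<in> {0, n + 1}. s i = None}"
proof -
  have "{j. j \<le> n + 1 \<and> s j = None} = {i. 1 \<le> i \<and> i < n \<and> s i = None} \<union> {i \<in> {0, n + 1}. s i = None}"
  proof (rule set_eqI)
    show "j \<in> {j. j \<le> n + 1 \<and> s j = None} \<longleftrightarrow>
      j \<in> {i. 1 \<le> i \<and> i < n \<and> s i = None} \<union> {i \<in> {0, n + 1}. s i = None}" for j
    proof -
      have "j \<le> n + 1 \<longleftrightarrow> j = 0 \<or> 1 \<le> j \<and> j < n \<or> j = n \<or> j = n + 1" by linarith
      then show ?thesis using assms by auto
    qed
  qed
  moreover have "{i. 1 \<le> i \<and> i < n \<and> s i = None} \<inter> {i \<in> {0, n + 1}. s i = None} = {}" by auto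
  ultimately show ?thesis unfolding free_def by (simp add: card_Un_disjoint)
qed

text \<open>Contrapositive of \<open>path_exhausted_parity\<close>: the wrong parity certifies that
  a move on the z path remains.\<close>

lemma legal_z_or_parity:
  assumes "ok s" "s (n - 1) = Some b" "s 1 \<noteq> Some (\<not> a)"
    "s 1 = None \<Longrightarrow> s 0 = Some (\<not> a) \<and> s n = Some (\<not> a)"
    "\<not> (even (card {i. 1 \<le> i \<and> i < n \<and> s i = None}) \<longleftrightarrow> a = b)"
  obtains i u where "1 \<le> i" "i < n" "legal s i u"
  using path_exhausted_parity[OF assms(1-4)] assms(5) by blast

lemma ok_chord: "ok s \<Longrightarrow> s n = Some t \<Longrightarrow> s (n + 1) \<noteq> Some (\<not> t)"
  unfolding ok_def by blast

lemma ok_start: "ok s \<Longrightarrow> s 0 = Some t \<Longrightarrow> s 1 = Some t \<Longrightarrow> s n \<noteq> Some t"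
  unfolding ok_def by blast

lemma ok_end: "ok s \<Longrightarrow> s 0 = Some t \<Longrightarrow> s (n - 1) = Some t \<Longrightarrow> s (n + 1) \<noteq> Some t"
  unfolding ok_def by blast

lemma sealed_update:
  assumes s: "sealed s" and l: "legal s j t"
  shows "sealed (s(j := Some t))"
proof -
  obtain T where T: "s 0 = Some T" "s n = Some T" "s (n - 1) = Some T" "s (n + 1) = None"
    using s unfolding sealed_def by blast
  have j: "s j = None" "ok (s(j := Some t))" using l by (auto simp: legal_def)
  \<comment> \<open>On y2, sign \<open>T\<close> is forbidden at vertex 1 by x and z_{n-1}, and the
    opposite sign is forbidden at vertex \<open>n\<close> by y1.\<close>
  have "j \<noteq> n + 1"
  proof
    assume [simp]: "j = n + 1"
    have e: "(s(j := Some t)) n = Some T" "(s(j := Some t)) (n + 1) = Some t" "(s(j := Some t)) 0 = Some T"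
      "(s(j := Some t)) (n - 1) = Some T"
      using T n_ge_3 by auto
    show False
      using ok_chord[OF j(2) e(1)] ok_end[OF j(2) e(3,4)] unfolding e(2) by simp
  qed
  then have "(s(j := Some t)) 0 = Some T" "(s(j := Some t)) n = Some T"
    "(s(j := Some t)) (n - 1) = Some T" "(s(j := Some t)) (n + 1) = None"
    using T j(1) by (auto simp del: One_nat_def)
  then show ?thesis using j(2) unfolding sealed_def by blast
qed

text \<open>Off the z path only y2 is unmarked, so an even number of z edges is unmarked. As x and
  y1 act like a preceding edge of sign opposite to \<open>T\<close> while z_{n-1} has sign
  \<open>T\<close>, an exhausted path would leave an odd number.\<close>

lemma sealed_answerable:
  assumes s: "sealed s" and odd: "odd (free s)"
  shows "answerable s"
proof -
  obtain T where T: "s 0 = Some T" "s n = Some T" "s (n - 1) = Some T" "s (n + 1) = None"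
    using s unfolding sealed_def by blast
  have ok: "ok s" using s by (simp add: sealed_def)
  have s1: "s 1 \<noteq> Some T" using ok T unfolding ok_def by blast
  have "{i \<in> {0, n + 1}. s i = None} = {n + 1}" using T by auto
  then have "even (card {i. 1 \<le> i \<and> i < n \<and> s i = None})"
    using odd free_split[of s] T by simp
  then obtain i u where i: "1 \<le> i" "i < n" "legal s i u"
    using legal_z_or_parity[OF ok T(3), of "\<not> T"] s1 T by auto
  then show ?thesis using sealed_update[OF s i(3)] answerableI[OF i(3)] by (simp add: good_def)
qed

lemma poisoned_update:
  assumes s: "poisoned s" and l: "legal s j t" and j: "1 \<le> j" "j < n"
  shows "poisoned (s(j := Some t))"
proof -
  obtain T where T: "s n = Some T" "s 1 = Some T" "s (n - 1) = Some T" "s 0 = None" "s (n + 1) = None"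
    using s unfolding poisoned_def by blast
  have none: "s j = None" "ok (s(j := Some t))" using l by (auto simp: legal_def)
  have "(s(j := Some t)) n = Some T" "(s(j := Some t)) 1 = Some T"
    "(s(j := Some t)) (n - 1) = Some T" "(s(j := Some t)) 0 = None" "(s(j := Some t)) (n + 1) = None"
    using T j none(1) by (auto simp del: One_nat_def)
  then show ?thesis using none(2) unfolding poisoned_def by blast
qed

text \<open>Off the z path x and y2 are unmarked, so an odd number of z edges is unmarked. Both ends
  of the path have the same sign, so an exhausted path would leave an even number.\<close>

lemma poisoned_answerable_odd:
  assumes s: "poisoned s" and odd: "odd (free s)"
  shows "answerable s"
proof -
  obtain T where T: "s n = Some T" "s 1 = Some T" "s (n - 1) = Some T" "s 0 = None" "s (n + 1) = None"
    using s unfolding poisoned_def by blast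
  have ok: "ok s" using s by (simp add: poisoned_def)
  have "{i \<in> {0, n + 1}. s i = None} = {0, n + 1}" using T by auto
  then have "odd (card {i. 1 \<le> i \<and> i < n \<and> s i = None})"
    using odd free_split[of s] T by simp
  then obtain i u where i: "1 \<le> i" "i < n" "legal s i u"
    using legal_z_or_parity[OF ok T(3), of T] T by auto
  then show ?thesis using poisoned_update[OF s i(3,1,2)] answerableI[OF i(3)] by (simp add: good_def)
qed

lemma odd_free_update: "legal s j t \<Longrightarrow> even (free s) \<Longrightarrow> odd (free (s(j := Some t)))"
  using free_update[of s j t] by simp

lemma not_cell_if_unmarked: "s n = None \<or> s (n + 1) = None \<Longrightarrow> \<not> cell s"
  unfolding cell_def by auto

lemma poisoned_answerable:
  assumes s: "poisoned s" and l: "legal s j t" and even: "even (free s)"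
  shows "\<not> cell (s(j := Some t)) \<and> answerable (s(j := Some t))"
proof -
  let ?s = "s(j := Some t)"
  obtain T where T: "s n = Some T" "s 1 = Some T" "s (n - 1) = Some T" "s 0 = None" "s (n + 1) = None"
    using s unfolding poisoned_def by blast
  have j: "s j = None" "ok ?s" "j \<le> n + 1" using l by (auto simp: legal_def)
  consider "j = 0" | "j = n + 1" | "1 \<le> j" "j < n" using T j by (cases "j = n") force+
  then show ?thesis
  proof cases
    case 1
    then have e: "?s n = Some T" "?s 1 = Some T" "?s 0 = Some t" "?s (n + 1) = None"
      "?s (n - 1) = Some T" using T n_ge_3 by auto
    \<comment> \<open>With z_1 and y1 of sign \<open>T\<close>, vertex 0 forces the opposite sign on
      x; now y2 completes the triangle.\<close>
    have t: "t = (\<not> T)" using ok_start[OF j(2), of t] unfolding e by auto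
    have "ok (?s(n + 1 := Some T))" by (rule ok_update_last[OF j(2)]) (use e t in auto)
    then have "legal ?s (n + 1) T" using e by (simp add: legal_def del: fun_upd_apply)
    moreover have "cell (?s(n + 1 := Some T))" using e t by (simp add: cell_def)
    ultimately show ?thesis using answerableI not_cell_if_unmarked e(4) by blast
  next
    case 2
    then have e: "?s n = Some T" "?s 1 = Some T" "?s 0 = None" "?s (n + 1) = Some t"
      "?s (n - 1) = Some T" using T n_ge_3 by auto
    \<comment> \<open>Vertex \<open>n\<close> forces y2 to agree with y1. This closes no cell yet,
      since x is unmarked and z_1 has the wrong sign for the long one; the reply on x closes the
      triangle.\<close>
    have t: "t = T" using ok_chord[OF j(2) e(1)] unfolding e by simp
    have "ok (?s(0 := Some (\<not> T)))" by (rule ok_update_0[OF j(2)]) (use e t in auto)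
    then have "legal ?s 0 (\<not> T)" using e by (simp add: legal_def del: fun_upd_apply)
    moreover have "cell (?s(0 := Some (\<not> T)))" using e t n_ge_3 by (simp add: cell_def)
    moreover have "\<not> cell ?s"
    proof
      assume "cell ?s"
      then have "\<forall>i. 1 \<le> i \<and> i < n \<longrightarrow> ?s i = Some (\<not> T)"
        unfolding cell_def e by auto
      then have "?s 1 = Some (\<not> T)" using n_ge_3 by simp
      then show False using e(2) by simp
    qed
    ultimately show ?thesis using answerableI by blast
  next
    case 3
    have "?s (n + 1) = None" using T 3 by auto
    then show ?thesis
      using poisoned_answerable_odd[OF poisoned_update[OF s l 3] odd_free_update[OF l even]]
        not_cell_if_unmarked by blast
  qed
qed

text \<open>y2 and the middle edge are answered by each other, which restores full symmetry. Other
  moves on the z path are mirrored, except sign \<open>T\<close> on z_{n-1}: its mirror image on z_1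
  is forbidden by x and y1, but the move itself kills y2.\<close>

lemma guarded_answerable:
  assumes s: "guarded s" and l: "legal s j t" and even: "even (free s)"
  shows "\<not> cell (s(j := Some t)) \<and> answerable (s(j := Some t))"
proof -
  let ?s = "s(j := Some t)"
  define h where "h = n div 2"
  have n: "even n" using s by (simp add: guarded_def)
  note h = middle[OF n, folded h_def]
  obtain T where T: "s 0 = Some T" "s n = Some T" "s (n + 1) = None" "s h = None"
    using s unfolding guarded_def h_def by blast
  have sym: "s (n - i) = s i" if "1 \<le> i" "i < n" for i using s that by (simp add: guarded_def)
  have ok: "ok s" using s by (simp add: guarded_def)
  have j: "s j = None" "ok ?s" "j \<le> n + 1" using l by (auto simp: legal_def)
  have s1: "s 1 \<noteq> Some T" using ok T unfolding ok_def by blast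
  moreover have "s (n - 1) = s 1" using sym[of 1] n_ge_3 by simp
  ultimately have sn1: "s (n - 1) \<noteq> Some T" by simp
  have "j \<noteq> 0" "j \<noteq> n" using T(1,2) j(1) by (metis option.distinct(1))+
  then have "j = n + 1 \<or> j = h \<or> (1 \<le> j \<and> j < n \<and> j \<noteq> h)" using j(3) by linarith
  then consider "j = n + 1" | "j = h" | "1 \<le> j" "j < n" "j \<noteq> h" by blast
  then show ?thesis
  proof cases
    case 1
    then have e: "?s n = Some T" "?s 0 = Some T" "?s (n + 1) = Some t" "?s h = None"
      using T h by auto
    have t: "t = T" using ok_chord[OF j(2) e(1)] unfolding e by simp
    have sym': "?s (n - i) = ?s i" if "1 \<le> i" "i < n" for i using sym[OF that] that 1 by auto
    obtain u where u: "ok (?s(h := Some u))"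
      using ok_update_middle[OF n j(2), folded h_def] e(4) sym' by blast
    have "?s \<circ> mir = ?s" by (rule symmetricI) (use sym' e t in \<open>auto simp del: fun_upd_apply\<close>)
    then have "?s(h := Some u) \<circ> mir = ?s(h := Some u)"
      by (rule symmetric_update_fixed) (rule h(6))
    then have "mirrored (?s(h := Some u))"
      using u e(2) h(1) by (intro mirroredI[OF n]) (auto simp: h_def)
    moreover have "legal ?s h u" using u e h by (simp add: legal_def del: fun_upd_apply)
    moreover have "\<not> cell ?s"
    proof
      assume "cell ?s"
      then have "?s 0 = Some (\<not> T) \<or> (\<forall>i. 1 \<le> i \<and> i < n \<longrightarrow> ?s i = Some (\<not> T))"
        unfolding cell_def e by auto
      moreover have "1 \<le> h" "h < n" using h(1,2) by auto
      ultimately show False using e by auto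
    qed
    ultimately show ?thesis using answerableI unfolding good_def by blast
  next
    case 2
    then have e: "?s n = Some T" "?s 0 = Some T" "?s (n + 1) = None" "?s h = Some t"
      "?s (n - 1) \<noteq> Some T"
      using T h sn1 by auto
    \<comment> \<open>Sign \<open>T\<close> on y2 is allowed at vertex 1 because z_{n-1}, like z_1,
      does not carry \<open>T\<close>.\<close>
    have ok': "ok (?s(n + 1 := Some T))" by (rule ok_update_last[OF j(2)]) (use e in auto)
    have sym': "?s (n - i) = ?s i" if "1 \<le> i" "i < n" for i
    proof (cases "i = h")
      case False
      then have "n - i \<noteq> h" using that h(3) by linarith
      then show ?thesis using sym[OF that] False 2 by simp
    qed (use h(3) in simp)
    have "?s(n + 1 := Some T) \<circ> mir = ?s(n + 1 := Some T)"
    proof (rule symmetricI)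
      show "(?s(n + 1 := Some T)) (n - i) = (?s(n + 1 := Some T)) i" if "1 \<le> i" "i < n" for i
        using sym'[OF that] that by auto
    qed (use e in simp)
    then have "mirrored (?s(n + 1 := Some T))"
      using ok' e h(2) by (intro mirroredI[OF n]) (auto simp: h_def)
    moreover have "legal ?s (n + 1) T" using ok' e by (simp add: legal_def del: fun_upd_apply)
    ultimately show ?thesis
      using answerableI not_cell_if_unmarked e(3) unfolding good_def by blast
  next
    case 3
    then have e: "?s n = Some T" "?s 0 = Some T" "?s (n + 1) = None" "?s h = None"
      using T by auto
    show ?thesis
    proof (cases "j = n - 1 \<and> t = T")
      case True
      \<comment> \<open>The opponent's own move seals the position, and the odd count of unmarked
        edges supplies a reply.\<close>
      then have "sealed ?s" using e j(2) unfolding sealed_def by auto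
      then show ?thesis
        using sealed_answerable odd_free_update[OF l even] not_cell_if_unmarked e(3) by blast
    next
      case False
      let ?k = "n - j"
      have "?k \<noteq> j" using 3 h(3) unfolding h_def by auto
      have k: "1 \<le> ?k" "?k < n" "?k \<noteq> h" using 3 h(3) by auto
      have ok': "ok (?s(?k := Some t))"
      proof (rule ok_mirror_path[OF _ 3(1,2) \<open>?k \<noteq> j\<close> j(1,2)])
        show "\<not> (s 0 = Some t \<and> s n = Some t)" if "?k = 1"
          using False that 3 T by auto
        show "\<not> (s 0 = Some t \<and> s (n + 1) = Some t)" using T by simp
      qed (use sym in auto)
      have "?s ?k = None" using sym[OF 3(1,2)] j(1) \<open>?k \<noteq> j\<close> by simp
      then have legal: "legal ?s ?k t" using ok' k by (simp add: legal_def del: fun_upd_apply)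
      have "(?s(?k := Some t)) (n - i) = (?s(?k := Some t)) i" if "1 \<le> i" "i < n" for i
      proof -
        have eqs: "n - i = j \<longleftrightarrow> i = ?k" "n - i = ?k \<longleftrightarrow> i = j" using that 3 by auto
        show ?thesis unfolding fun_upd_apply eqs sym[OF that] by simp
      qed
      then have "guarded (?s(?k := Some t))"
        using n ok' e k unfolding guarded_def h_def by auto
      then show ?thesis
        using answerableI[OF legal] not_cell_if_unmarked e(3) unfolding good_def by blast
    qed
  qed
qed

text \<open>x and the middle edge are answered by each other and all other z moves are mirrored. The
  delicate moves are y1 and y2; the second reduces to the first by reflection.\<close>

lemma unbroken_answerable:
  assumes s: "unbroken s" and l: "legal s j t" and even: "even (free s)"
  shows "\<not> cell (s(j := Some t)) \<and> answerable (s(j := Some t))"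
proof
  define h where "h = n div 2"
  have n: "even n" and ok: "ok s" and sym: "s \<circ> mir = s" and none: "s 0 = None" "s n = None" "s h = None"
    using s by (auto simp: unbroken_def h_def)
  note h = middle[OF n, folded h_def]
  have none': "s (n + 1) = None" using symmetric_triangle[OF sym] none by simp
  have path: "s (n - i) = s i" if "1 \<le> i" "i < n" for i by (rule symmetric_path[OF sym that])
  have p1: "s (n - 1) = s 1" using path[of 1] n_ge_3 by simp
  have j: "s j = None" "ok (s(j := Some t))" "j \<le> n + 1" using l by (auto simp: legal_def)
  have "(s(j := Some t)) n = None \<or> (s(j := Some t)) (n + 1) = None" using none none' by auto
  then show "\<not> cell (s(j := Some t))" by (rule not_cell_if_unmarked)
  have chord: "answerable (s(n := Some t))" if l: "legal s n t" for t
  proof -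
    let ?s = "s(n := Some t)"
    have ok: "ok ?s" using l by (simp add: legal_def)
    have e: "?s n = Some t" "?s 0 = None" "?s (n + 1) = None" "?s h = None" "?s 1 = s 1"
      "?s (n - 1) = s 1" using none none' h n_ge_3 p1 by auto
    show ?thesis
    \<comment> \<open>By symmetry z_1 and z_{n-1} agree. If both have sign \<open>t\<close>, the
      position is already poisoned and parity yields a reply; otherwise x can take sign
      \<open>t\<close>, which guards the triangle.\<close>
    proof (cases "s 1 = Some t")
      case True
      then have "poisoned ?s" using e ok unfolding poisoned_def by metis
      then show ?thesis using poisoned_answerable_odd odd_free_update[OF l even] by blast
    next
      case False
      have ok': "ok (?s(0 := Some t))" by (rule ok_update_0[OF ok]) (use e False in auto)
      have "(?s(0 := Some t)) (n - i) = (?s(0 := Some t)) i" if "1 \<le> i" "i < n" for i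
        using path[OF that] that by auto
      moreover have "(?s(0 := Some t)) h = None" "(?s(0 := Some t)) (n + 1) = None"
        "(?s(0 := Some t)) 0 = Some t" "(?s(0 := Some t)) n = Some t"
        using e h(1) by auto
      ultimately have "guarded (?s(0 := Some t))"
        using n ok' unfolding guarded_def h_def by blast
      moreover have "legal ?s 0 t" using ok' e by (simp add: legal_def del: fun_upd_apply)
      ultimately show ?thesis using answerableI unfolding good_def by blast
    qed
  qed
  let ?s = "s(j := Some t)"
  have "j = 0 \<or> j = n + 1 \<or> j = n \<or> j = h \<or> (1 \<le> j \<and> j < n \<and> j \<noteq> h)" using j(3) by linarith
  then consider "j = 0" | "j = n + 1" | "j = n" | "j = h" | "1 \<le> j" "j < n" "j \<noteq> h" by blast
  then show "answerable ?s"
  proof cases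
    case 1
    have sym': "?s \<circ> mir = ?s" by (rule symmetric_update_fixed[OF sym]) (simp add: 1)
    have e: "?s h = None" "?s 0 = Some t" using none h(1) 1 by auto
    obtain u where u: "ok (?s(h := Some u))"
      using ok_update_middle[OF n j(2), folded h_def] e(1) symmetric_path[OF sym'] by blast
    have "mirrored (?s(h := Some u))"
      by (rule mirroredI[OF n u symmetric_update_fixed[OF sym' h(6)]])
        (use e h(1) in \<open>auto simp: h_def\<close>)
    moreover have "legal ?s h u" using u e h(2) by (simp add: legal_def del: fun_upd_apply)
    ultimately show ?thesis using answerableI unfolding good_def by blast
  next
    case 2
    have "legal s n t"
      using l legal_mir[of s n t] 2 sym by simp
    moreover have "?s \<circ> mir = s(n := Some t)"
      using 2 sym by (simp add: comp_mir_update)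
    ultimately show ?thesis using chord answerable_mir[of ?s] by simp
  next
    case 3
    then show ?thesis using chord l by blast
  next
    case 4
    have sym': "?s \<circ> mir = ?s" by (rule symmetric_update_fixed[OF sym]) (use 4 h in simp)
    have e: "?s 0 = None" "?s n = None" "?s (n + 1) = None" "?s h = Some t"
      using none none' h 4 by auto
    \<comment> \<open>The sign is arbitrary: with y1 and y2 unmarked, neither vertex 0 nor vertex 1
      restricts x.\<close>
    have ok': "ok (?s(0 := Some True))" by (rule ok_update_0[OF j(2)]) (use e in auto)
    have "mirrored (?s(0 := Some True))"
      by (rule mirroredI[OF n ok' symmetric_update_fixed[OF sym']])
        (use e h(1) in \<open>auto simp: h_def\<close>)
    moreover have "legal ?s 0 True" using ok' e by (simp add: legal_def del: fun_upd_apply)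
    ultimately show ?thesis using answerableI unfolding good_def by blast
  next
    case 5
    have m: "mir j = n - j" using 5 by simp
    have "n - j \<noteq> j" using 5 h(3) unfolding h_def by auto
    then have legal: "legal ?s (mir j) t" using symmetric_mirror_reply[OF sym l] m by simp
    have k: "1 \<le> n - j" "n - j < n" "n - j \<noteq> h" using 5 h(3) by auto
    have "unbroken (?s(mir j := Some t))"
      unfolding unbroken_def
    proof (intro conjI)
      show "?s(mir j := Some t) \<circ> mir = ?s(mir j := Some t)" by (rule symmetric_update[OF sym])
      show "ok (?s(mir j := Some t))" using legal by (simp add: legal_def)
    qed (use n none k 5 m in \<open>auto simp: h_def\<close>)
    then show ?thesis using answerableI[OF legal] unfolding good_def by blast
  qed
qed

section \<open>Winning strategies for both parities\<close>

lemma good_answerable: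
  assumes "good s" "even (free s)" "\<not> cell s" "legal s j t"
  shows "\<not> cell (s(j := Some t)) \<and> answerable (s(j := Some t))"
proof -
  have "sealed s \<Longrightarrow> ?thesis"
    using sealed_answerable[OF sealed_update odd_free_update] sealed_update[of s j t] assms
      not_cell_if_unmarked[of "s(j := Some t)"] unfolding sealed_def by blast
  then show ?thesis
    using assms mirrored_answerable unbroken_answerable guarded_answerable poisoned_answerable
    unfolding good_def by blast
qed

lemma good_mir_answerable:
  assumes "good s \<or> good (s \<circ> mir)" "even (free s)" "\<not> cell s" "legal s j t"
  shows "\<not> cell (s(j := Some t)) \<and> answerable (s(j := Some t))"
proof (cases "good s")
  case True
  then show ?thesis using good_answerable assms by blast
next
  case False
  have e: "(s \<circ> mir)(mir j := Some t) = s(j := Some t) \<circ> mir" by (simp add: comp_mir_update)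
  have "legal (s \<circ> mir) (mir j) t" using assms(4) by (simp add: legal_mir)
  moreover have "even (free (s \<circ> mir))" "\<not> cell (s \<circ> mir)" using assms by (simp_all add: free_mir cell_mir)
  ultimately have "\<not> cell (s(j := Some t) \<circ> mir) \<and> answerable (s(j := Some t) \<circ> mir)"
    using good_answerable[of "s \<circ> mir" "mir j" t] assms(1) False unfolding e by blast
  then show ?thesis unfolding cell_mir answerable_mir .
qed

text \<open>The invariant includes an even number of unmarked edges, preserved since a round marks
  two; the parity endgames depend on it.\<close>

lemma good_losing:
  assumes "good s \<or> good (s \<circ> mir)" "even (free s)" "\<not> cell s" "free s \<le> k"
  shows "\<not> wins k s"
proof (rule losing_strategy)
  let ?P = "\<lambda>s. (good s \<or> good (s \<circ> mir)) \<and> even (free s) \<and> \<not> cell s"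
  show "?P s" using assms by blast
  fix s j t
  assume P: "?P s" and l: "legal s j t"
  then have a: "\<not> cell (s(j := Some t))" "answerable (s(j := Some t))"
    using good_mir_answerable by blast+
  then obtain i u where i: "legal (s(j := Some t)) i u"
    and g: "cell (s(j := Some t, i := Some u)) \<or> good (s(j := Some t, i := Some u)) \<or>
      good (s(j := Some t, i := Some u) \<circ> mir)"
    unfolding answerable_def by blast
  have "even (free (s(j := Some t, i := Some u)))"
    using P free_update[OF l] free_update[OF i] by simp
  then show "\<not> cell (s(j := Some t)) \<and> (\<exists>i u. legal (s(j := Some t)) i u \<and>
      (cell (s(j := Some t, i := Some u)) \<or> ?P (s(j := Some t, i := Some u))))"
    using a i g by blast
qed (rule assms(4))

lemma answerable_wins:
  assumes "answerable s" "odd (free s)" "free s \<le> Suc k"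
  shows "wins (Suc k) s"
proof -
  obtain i u where i: "legal s i u"
    and g: "cell (s(i := Some u)) \<or> good (s(i := Some u)) \<or> good (s(i := Some u) \<circ> mir)"
    using assms(1) unfolding answerable_def by blast
  have "free s = Suc (free (s(i := Some u)))" by (rule free_update[OF i])
  then have "cell (s(i := Some u)) \<or> \<not> wins k (s(i := Some u))"
    using g good_losing[of "s(i := Some u)" k] assms(2,3) by auto
  then show ?thesis using i by auto
qed

lemma pos_empty: "pos (\<lambda>_. None) = {}"
  by (simp add: pos_def)

lemma free_empty: "free (\<lambda>_. None) = n + 2"
proof -
  have "{j. j \<le> n + 1 \<and> (\<lambda>_. None :: bool option) j = None} = {..n + 1}" by auto
  then show ?thesis by (simp add: free_def)
qed

lemma mover_wins_pos: "mover_wins B (pos s) \<longleftrightarrow> wins (Suc (n + 1)) s"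
proof -
  have "n + 2 = Suc (n + 1)" by simp
  then show ?thesis unfolding mover_wins_def card_edges mover_wins_fuel_pos by (rule arg_cong)
qed

lemma player1_wins_odd:
  assumes "odd n"
  shows "player1_wins B"
proof -
  let ?s = "(\<lambda>_. None)(0 := Some True)"
  have l: "legal (\<lambda>_. None) 0 True" by (simp add: legal_def ok_def)
  \<comment> \<open>A self-mirrored z edge would need \<open>n = 2 * j\<close>, so for odd
    \<open>n\<close> Player 1's opening on x leaves no unmarked self-mirrored edge.\<close>
  have fixed: "mir j = j \<Longrightarrow> j \<le> n + 1 \<Longrightarrow> j = 0" for j
  proof (rule ccontr)
    assume *: "mir j = j" "j \<le> n + 1" "j \<noteq> 0"
    then have "n = 2 * j" unfolding mir_def by (auto split: if_splits)
    then show False using assms by simp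
  qed
  have "mirrored ?s"
    unfolding mirrored_def
  proof (intro conjI allI impI)
    show "ok ?s" using l by (simp add: legal_def)
    show "?s \<circ> mir = ?s" by (rule symmetricI) (use n_ge_3 in auto)
    show "?s j \<noteq> None" if "j \<le> n + 1" "mir j = j" for j using fixed[OF that(2,1)] by simp
  qed
  moreover have f: "free ?s = n + 1" using free_update[OF l] free_empty by simp
  moreover have "\<not> cell ?s" using n_ge_3 by (simp add: cell_def)
  ultimately have "\<not> wins (n + 1) ?s"
    using good_losing[of ?s "n + 1"] assms by (simp add: good_def del: fun_upd_apply)
  then have "wins (Suc (n + 1)) (\<lambda>_. None)" using l unfolding wins.simps by blast
  then show ?thesis using mover_wins_pos[of "\<lambda>_. None"] by (simp add: player1_wins_def pos_empty)
qed

lemma player2_wins_even: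
  assumes "even n"
  shows "player2_wins B"
proof -
  let ?e = "\<lambda>_ :: nat. None :: bool option"
  have "unbroken ?e"
    using assms by (simp add: unbroken_def ok_def fun_eq_iff)
  then have g: "good ?e" by (simp add: good_def)
  have "\<not> cell ?e" by (simp add: cell_def)
  have ev: "even (free ?e)" using assms by (simp add: free_empty)
  have "\<not> has_cycle_cell B {m} \<and> mover_wins B {m}" if mem: "m \<in> legal_moves B {}" for m
  proof -
    obtain j t where m: "m = (if t then (src j, dst j) else (dst j, src j))" and l: "legal ?e j t"
      using mem legal_moves_pos[of ?e] unfolding pos_empty by blast
    have p: "{m} = pos (?e(j := Some t))"
      using insert_move_pos[OF l] unfolding pos_empty m .
    \<comment> \<open>For even \<open>n\<close> the empty position is unbroken with
      \<open>n + 2\<close> unmarked edges, so each opening has an answer.\<close>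
    have a: "\<not> cell (?e(j := Some t))" "answerable (?e(j := Some t))"
      using good_answerable[OF g ev \<open>\<not> cell ?e\<close> l] by blast+
    have "free (?e(j := Some t)) \<le> Suc (n + 1)" using free_update[OF l] free_empty by simp
    then have "wins (Suc (n + 1)) (?e(j := Some t))"
      using answerable_wins[OF a(2) odd_free_update[OF l ev]] by blast
    then show ?thesis using a(1) unfolding p has_cycle_cell_pos mover_wins_pos by blast
  qed
  then show ?thesis unfolding player2_wins_def by blast
qed

end

theorem theorem4p5:
  fixes n :: nat
  assumes "n \<ge> 3"
  shows "(odd n \<longrightarrow> player1_wins (cycle_chord_board n)) \<and>
         (even n \<longrightarrow> player2_wins (cycle_chord_board n))"
proof -
  interpret chord_board n using assms by unfold_locales
  show ?thesis using player1_wins_odd player2_wins_even by blast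
qed

end
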